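(* Let $E$ be an infinite connected locally finite bi-graph with underlying graph $\mathcal{E}$. Then there exists a rose-tree bi-graph $\tilde E$, with underlying graph $\tilde{\mathcal{E}}$, such that there are natural isomorphisms $$K_i(\mathcal{O}_{\mathcal{E}})\cong K_i(\mathcal{O}_{\tilde{\mathcal{E}}}),\qquad i=0,1.$$
   Context: Graphs may have loops and multiple edges; locally finite means that each vertex has finitely many incident edges. A bi-graph is a locally finite directed graph $E=(E^0,E^1,s,r)$ (vertices, edges, source, range) together with an involution $\xi\mapsto\overline{\xi}$ on $E^1$ and a decomposition $E^1=E^{1,0}\sqcup E^{1,1}$ such that $\overline{\,\cdot\,}$ maps $E^{1,0}$ bijectively onto $E^{1,1}$ and vice versa, and $s(\overline{\xi})=r(\xi)$, $r(\overline{\xi})=s(\xi)$. A pair $\{\xi,\overline{\xi}\}$ is called a bi-edge. The underlying graph $\mathcal{E}$ of $E$ is the undirected graph with vertex set $E^0$ and one edge for each bi-edge of $E$; conversely every locally finite undirected graph $\mathcal{E}$ has an associated bi-graph $E$, obtained by replacing each edge (including each loop) by a bi-edge. $E$ is connected (infinite) if $\mathcal{E}$ is. A rose-tree bi-graph is a bi-graph $E$ such that $E^1=B\sqcup P$ where $(E^0,B,s,r)$ is a bi-graph whose underlying graph is a tree, and $s(\xi)=r(\xi)$ for every $\xi\in P$ (finitely many loops are attached to each vertex, by local finiteness). Let $\mathbb{Z}^{|E^1|}$ be the free abelian group with basis $E^1$. The Bass–Hashimoto operator $\Phi\colon\mathbb{Z}^{|E^1|}\to\mathbb{Z}^{|E^1|}$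 is defined on basis elements by $\Phi(x)=\Big(\sum_{x'\in E^1,\ s(x')=r(x)}x'\Big)-\overline{x}$. Its $0$–$1$ matrix $A=(A_{x,y})_{x,y\in E^1}$ is given by $\Phi(x)=\sum_y A_{x,y}\,y$, and $\mathcal{O}_{\mathcal{E}}$ is the Cuntz–Krieger $C^*$-algebra of $A$, generated by partial isometries $S_x$ ($x\in E^1$), with mutually orthogonal range projections, subject to $S_x^*S_x=\sum_y A_{x,y}S_yS_y^*$. By known results, $K_0(\mathcal{O}_{\mathcal{E}})\cong\operatorname{coker}(\mathrm{Id}-\Phi)$ and $K_1(\mathcal{O}_{\mathcal{E}})\cong\ker(\mathrm{Id}-\Phi)$; the $K$-groups are understood through these identifications. "Natural" is used informally, meaning that the isomorphism arises from an explicit construction; no functoriality is asserted. *)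

theory Defs
  imports "HOL-Algebra.Free_Abelian_Groups" "Graph_Theory.Digraph"
begin

section \<open>Undirected multigraphs\<close>

text \<open>Loops and parallel edges are allowed; a loop at \<open>v\<close> has the end set \<open>{v}\<close>.\<close>

record ('v, 'b) multigraph =
  mverts :: "'v set"
  medges :: "'b set"
  mends :: "'b \<Rightarrow> 'v set"

definition mconnected :: "('v, 'b) multigraph \<Rightarrow> bool" where
  "mconnected H \<longleftrightarrow> mverts H \<noteq> {} \<and>
     (\<forall>u\<in>mverts H. \<forall>v\<in>mverts H.
        (u, v) \<in> {(x, y). \<exists>b\<in>medges H. mends H b = {x, y}}\<^sup>*)"

definition minfinite :: "('v, 'b) multigraph \<Rightarrow> bool" where
  "minfinite H \<longleftrightarrow> infinite (mverts H)"

text \<open>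
  A cycle visits the pairwise distinct vertices \<open>vs\<close> along the pairwise distinct edges \<open>bs\<close>
  and then returns to its starting vertex. Its length is any number \<open>\<ge> 1\<close>: a loop is a cycle of
  length 1 and two parallel edges form a cycle of length 2, whereas going back and forth along
  a single edge is not a cycle.
\<close>

definition mcycle :: "('v, 'b) multigraph \<Rightarrow> 'v list \<Rightarrow> 'b list \<Rightarrow> bool" where
  "mcycle H vs bs \<longleftrightarrow>
     bs \<noteq> [] \<and> length vs = length bs \<and> distinct vs \<and> distinct bs \<and>
     set vs \<subseteq> mverts H \<and> set bs \<subseteq> medges H \<and>
     (\<forall>i<length bs. mends H (bs ! i) = {vs ! i, vs ! (Suc i mod length bs)})"

definition mtree :: "('v, 'b) multigraph \<Rightarrow> bool" where
  "mtree H \<longleftrightarrow> mconnected H \<and> (\<nexists>vs bs. mcycle H vs bs)"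


section \<open>Bi-graphs\<close>

text \<open>
  The source and range maps are \<^const>\<open>tail\<close> and \<^const>\<open>head\<close> of the directed graph; \<open>arcs0\<close> and
  \<open>arcs1\<close> are the two parts $E^{1,0}$ and $E^{1,1}$ of the edge set.
\<close>

record ('v, 'e) bigraph =
  dgraph :: "('v, 'e) pre_digraph"
  bar :: "'e \<Rightarrow> 'e"
  arcs0 :: "'e set"
  arcs1 :: "'e set"

definition locally_finite :: "('v, 'e) pre_digraph \<Rightarrow> bool" where
  "locally_finite G \<longleftrightarrow> (\<forall>v\<in>verts G. finite (out_arcs G v \<union> in_arcs G v))"

definition is_bigraph :: "('v, 'e) bigraph \<Rightarrow> bool" where
  "is_bigraph E \<longleftrightarrow>
     wf_digraph (dgraph E) \<and> locally_finite (dgraph E) \<and>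
     (\<forall>\<xi>\<in>arcs (dgraph E). bar E (bar E \<xi>) = \<xi>) \<and>
     arcs0 E \<union> arcs1 E = arcs (dgraph E) \<and> arcs0 E \<inter> arcs1 E = {} \<and>
     bij_betw (bar E) (arcs0 E) (arcs1 E) \<and> bij_betw (bar E) (arcs1 E) (arcs0 E) \<and>
     (\<forall>\<xi>\<in>arcs (dgraph E). tail (dgraph E) (bar E \<xi>) = head (dgraph E) \<xi> \<and>
                            head (dgraph E) (bar E \<xi>) = tail (dgraph E) \<xi>)"

text \<open>
  The edges of the underlying graph are the bi-edges \<open>{\<xi>, bar \<xi>}\<close>. Since the source of \<open>bar \<xi>\<close> is
  the range of \<open>\<xi>\<close>, the set of sources of the two members is the set of end points.
\<close>

definition underlying :: "('v, 'e) bigraph \<Rightarrow> ('v, 'e set) multigraph" where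
  "underlying E =
     \<lparr>mverts = verts (dgraph E),
      medges = (\<lambda>\<xi>. {\<xi>, bar E \<xi>}) ` arcs (dgraph E),
      mends = (\<lambda>b. tail (dgraph E) ` b)\<rparr>"

text \<open>The structure $(E^0, B, s, r)$ on all vertices with edge set \<open>B\<close>.\<close>

definition restrict_arcs :: "('v, 'e) bigraph \<Rightarrow> 'e set \<Rightarrow> ('v, 'e) bigraph" where
  "restrict_arcs E B =
     \<lparr>dgraph = (dgraph E)\<lparr>arcs := B\<rparr>, bar = bar E, arcs0 = arcs0 E \<inter> B, arcs1 = arcs1 E \<inter> B\<rparr>"

definition rose_tree_bigraph :: "('v, 'e) bigraph \<Rightarrow> bool" where
  "rose_tree_bigraph E \<longleftrightarrow> is_bigraph E \<and>
     (\<exists>B P. arcs (dgraph E) = B \<union> P \<and> B \<inter> P = {} \<and>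
        is_bigraph (restrict_arcs E B) \<and> mtree (underlying (restrict_arcs E B)) \<and>
        (\<forall>\<xi>\<in>P. tail (dgraph E) \<xi> = head (dgraph E) \<xi>))"


section \<open>The Bass--Hashimoto operator and the K-groups\<close>

text \<open>
  The free abelian group on the edge set consists of the finitely supported functions
  \<^typ>\<open>'e \<Rightarrow>\<^sub>0 int\<close> whose support \<^const>\<open>Poly_Mapping.keys\<close> lies in the edge set, and
  \<^const>\<open>frag_extend\<close> is additive extension from the basis.
\<close>

abbreviation arc_group :: "('v, 'e) bigraph \<Rightarrow> ('e \<Rightarrow>\<^sub>0 int) monoid" where
  "arc_group E \<equiv> free_Abelian_group (arcs (dgraph E))"

definition bass_hashimoto :: "('v, 'e) bigraph \<Rightarrow> ('e \<Rightarrow>\<^sub>0 int) \<Rightarrow> ('e \<Rightarrow>\<^sub>0 int)" where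
  "bass_hashimoto E =
     frag_extend (\<lambda>x. (\<Sum>x'\<in>out_arcs (dgraph E) (head (dgraph E) x). frag_of x')
                        - frag_of (bar E x))"

definition id_minus_bh :: "('v, 'e) bigraph \<Rightarrow> ('e \<Rightarrow>\<^sub>0 int) \<Rightarrow> ('e \<Rightarrow>\<^sub>0 int)" where
  "id_minus_bh E = (\<lambda>c. c - bass_hashimoto E c)"

text \<open>
  The K-groups of the Cuntz--Krieger algebra of the underlying graph are taken in their
  identification with the cokernel and the kernel of \<^const>\<open>id_minus_bh\<close>; the algebra itself is
  not constructed.
\<close>

definition K0_group :: "('v, 'e) bigraph \<Rightarrow> ('e \<Rightarrow>\<^sub>0 int) set monoid" where
  "K0_group E = arc_group E Mod (id_minus_bh E ` carrier (arc_group E))"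

definition K1_group :: "('v, 'e) bigraph \<Rightarrow> ('e \<Rightarrow>\<^sub>0 int) monoid" where
  "K1_group E =
     (arc_group E)\<lparr>carrier := kernel (arc_group E) (arc_group E) (id_minus_bh E)\<rparr>"

text \<open>On a bi-graph, \<open>Id - \<Phi>\<close> is an endomorphism, so that both groups are well defined.\<close>

lemma id_minus_bh_hom:
  assumes "is_bigraph E"
  shows "id_minus_bh E \<in> hom (arc_group E) (arc_group E)"
proof -
  have bar_in: "bar E x \<in> arcs (dgraph E)" if "x \<in> arcs (dgraph E)" for x
    using assms that unfolding is_bigraph_def bij_betw_def by blast
  have gen: "(\<Sum>x'\<in>out_arcs (dgraph E) (head (dgraph E) x). frag_of x') - frag_of (bar E x)
      \<in> carrier (arc_group E)" if "x \<in> arcs (dgraph E)" for x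
  proof -
    let ?S = "\<Sum>x'\<in>out_arcs (dgraph E) (head (dgraph E) x). frag_of x'"
    have "Poly_Mapping.keys ?S
        \<subseteq> (\<Union>x'\<in>out_arcs (dgraph E) (head (dgraph E) x). Poly_Mapping.keys (frag_of x'))"
      by (rule Poly_Mapping.keys_sum)
    also have "\<dots> \<subseteq> arcs (dgraph E)"
      by (auto simp: out_arcs_def)
    finally have "Poly_Mapping.keys ?S \<subseteq> arcs (dgraph E)" .
    then show ?thesis
      using keys_diff[of ?S "frag_of (bar E x)"] bar_in[OF that]
      by (auto simp: free_Abelian_group_def)
  qed
  have "bass_hashimoto E c \<in> carrier (arc_group E)" if "c \<in> carrier (arc_group E)" for c
    using that keys_frag_extend[of _ c] gen
    unfolding bass_hashimoto_def free_Abelian_group_def by fastforce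
  then show ?thesis
    unfolding id_minus_bh_def
    by (auto simp: hom_def free_Abelian_group_def bass_hashimoto_def frag_extend_add
        dest!: subsetD[OF keys_diff])
qed

end

theory Submission
  imports Defs
begin

text \<open>
  Choose a spanning tree of the underlying graph and turn every bi-edge outside it into a loop at one
  of its ends. Both K-groups of either graph are free abelian, with a basis that refers only to data
  shared by the two graphs. The kernel consists of the finitely supported cycles (the vertex sums
  vanish since the graph is infinite), so the bi-edges outside the tree form a basis through their
  fundamental cycles. For the cokernel, every vertex is left along a tree arc in such a way that no
  vertex is reached from infinitely many others; this assigns to each vertex a bi-edge that its
  relation eliminates, and the remaining bi-edges together with the common value of all stars
  (sums of the arcs leaving a vertex) form a basis.
\<close>

section \<open>Free abelian groups\<close>

lemma frag_extend_hom:
  assumes "\<And>x. x \<in> S \<Longrightarrow> Poly_Mapping.keys (b x) \<subseteq> T"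
  shows "frag_extend b \<in> hom (free_Abelian_group S) (free_Abelian_group T)"
  using assms keys_frag_extend[of b] by (fastforce simp: hom_def frag_extend_add)

lemma keys_diff_subset:
  fixes a b :: "'a \<Rightarrow>\<^sub>0 int"
  assumes "Poly_Mapping.keys a \<subseteq> S" "Poly_Mapping.keys b \<subseteq> S"
  shows "Poly_Mapping.keys (a - b) \<subseteq> S"
  using assms keys_diff[of a b] by blast

lemma keys_add_subset:
  fixes a b :: "'a \<Rightarrow>\<^sub>0 int"
  assumes "Poly_Mapping.keys a \<subseteq> S" "Poly_Mapping.keys b \<subseteq> S"
  shows "Poly_Mapping.keys (a + b) \<subseteq> S"
  using assms Poly_Mapping.keys_add[of a b] by blast

lemma keys_sum_subset:
  fixes a :: "'i \<Rightarrow> 'a \<Rightarrow>\<^sub>0 int"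
  assumes "\<And>i. i \<in> I \<Longrightarrow> Poly_Mapping.keys (a i) \<subseteq> S"
  shows "Poly_Mapping.keys (sum a I) \<subseteq> S"
  using assms Poly_Mapping.keys_sum[of a I] by blast

section \<open>Bi-graphs\<close>

locale bi_graph =
  fixes G :: "('v, 'e) bigraph"
  assumes bigraph: "is_bigraph G"
begin

abbreviation V where "V \<equiv> verts (dgraph G)"
abbreviation A where "A \<equiv> arcs (dgraph G)"
abbreviation src where "src \<equiv> tail (dgraph G)"
abbreviation tgt where "tgt \<equiv> head (dgraph G)"

lemma src_in_V [simp]: "x \<in> A \<Longrightarrow> src x \<in> V"
  and tgt_in_V [simp]: "x \<in> A \<Longrightarrow> tgt x \<in> V"
  and bar_bar [simp]: "x \<in> A \<Longrightarrow> bar G (bar G x) = x"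
  and src_bar [simp]: "x \<in> A \<Longrightarrow> src (bar G x) = tgt x"
  and tgt_bar [simp]: "x \<in> A \<Longrightarrow> tgt (bar G x) = src x"
  and arcs0_in_A: "x \<in> arcs0 G \<Longrightarrow> x \<in> A"
  using bigraph by (auto simp: is_bigraph_def wf_digraph_def)

lemma bar_in_A [simp]: "x \<in> A \<Longrightarrow> bar G x \<in> A"
  and bar_in_arcs0_iff: "x \<in> A \<Longrightarrow> bar G x \<in> arcs0 G \<longleftrightarrow> x \<notin> arcs0 G"
  using bigraph unfolding is_bigraph_def bij_betw_def by blast+

lemma finite_out_arcs: "v \<in> V \<Longrightarrow> finite (out_arcs (dgraph G) v)"
  and finite_in_arcs: "v \<in> V \<Longrightarrow> finite (in_arcs (dgraph G) v)"
  using bigraph by (auto simp: is_bigraph_def locally_finite_def)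

text \<open>When the chosen member of a bi-edge points the wrong way, its \<open>bar\<close> is the
  required arc.\<close>

lemma underlying_adjacent_iff:
  "(\<exists>b\<in>medges (underlying G). mends (underlying G) b = {u, v})
     \<longleftrightarrow> (\<exists>x\<in>A. src x = u \<and> tgt x = v)"
  (is "?L \<longleftrightarrow> ?R")
proof
  assume ?L
  then obtain x where x: "x \<in> A" "{src x, tgt x} = {u, v}"
    by (auto simp: underlying_def)
  then have "(src x = u \<and> tgt x = v) \<or> (src (bar G x) = u \<and> tgt (bar G x) = v)"
    by (auto simp: doubleton_eq_iff)
  then show ?R
    using x(1) bar_in_A by blast
next
  assume ?R
  then show ?L
    by (force simp: underlying_def)
qed

lemma mconnected_iff:
  "mconnected (underlying G) \<longleftrightarrow>
     V \<noteq> {} \<and> (\<forall>u\<in>V. \<forall>v\<in>V. (u, v) \<in> {(u, v). \<exists>x\<in>A. src x = u \<and> tgt x = v}\<^sup>*)"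
  unfolding mconnected_def underlying_adjacent_iff by (simp add: underlying_def)

text \<open>Propagation along arcs in the forward direction suffices, since every bi-edge also
  provides the reversed arc.\<close>

lemma connected_induct [consumes 3, case_names base step]:
  assumes "mconnected (underlying G)" "u \<in> V" "v \<in> V"
    and base: "P u"
    and step: "\<And>x. x \<in> A \<Longrightarrow> P (src x) \<Longrightarrow> P (tgt x)"
  shows "P v"
proof -
  have "(u, v) \<in> {(u, v). \<exists>x\<in>A. src x = u \<and> tgt x = v}\<^sup>*"
    using assms(1-3) unfolding mconnected_iff by blast
  then show ?thesis
    by induction (use base step in auto)
qed

section \<open>Stars and the values of Id - Phi on the basis\<close>

definition star :: "'v \<Rightarrow> 'e \<Rightarrow>\<^sub>0 int" where
  "star v = (\<Sum>x\<in>out_arcs (dgraph G) v. frag_of x)"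

lemma keys_star: "Poly_Mapping.keys (star v) \<subseteq> A"
  unfolding star_def by (rule keys_sum_subset) auto

lemma id_minus_bh_frag_of:
  "id_minus_bh G (frag_of x) = frag_of x + frag_of (bar G x) - star (tgt x)"
  by (simp add: id_minus_bh_def bass_hashimoto_def star_def)

lemma id_minus_bh_diff: "id_minus_bh G (a - b) = id_minus_bh G a - id_minus_bh G b"
  by (simp add: id_minus_bh_def bass_hashimoto_def frag_extend_diff)

lemma id_minus_bh_add: "id_minus_bh G (a + b) = id_minus_bh G a + id_minus_bh G b"
  by (simp add: id_minus_bh_def bass_hashimoto_def frag_extend_add)

lemma id_minus_bh_zero [simp]: "id_minus_bh G 0 = 0"
  by (simp add: id_minus_bh_def bass_hashimoto_def)

section \<open>The cokernel\<close>

abbreviation bh_image :: "('e \<Rightarrow>\<^sub>0 int) set" where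
  "bh_image \<equiv> id_minus_bh G ` carrier (arc_group G)"

lemma bh_image_diff:
  assumes "a \<in> bh_image" "b \<in> bh_image"
  shows "a - b \<in> bh_image"
proof -
  obtain x y where "Poly_Mapping.keys x \<subseteq> A" "Poly_Mapping.keys y \<subseteq> A"
      "a - b = id_minus_bh G (x - y)"
    using assms by (auto simp: id_minus_bh_diff)
  then show ?thesis
    using keys_diff_subset[of x A y] by simp
qed

lemma bh_image_zero: "0 \<in> bh_image"
  using image_eqI[of 0 "id_minus_bh G" 0 "carrier (arc_group G)"] by simp

lemma bh_image_add: "a \<in> bh_image \<Longrightarrow> b \<in> bh_image \<Longrightarrow> a + b \<in> bh_image"
  using bh_image_diff[of a "0 - b"] bh_image_diff[of 0 b] bh_image_zero by simp

lemma bh_image_sum: "(\<And>i. i \<in> I \<Longrightarrow> a i \<in> bh_image) \<Longrightarrow> sum a I \<in> bh_image"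
  by (induction I rule: infinite_finite_induct) (auto simp: bh_image_zero intro!: bh_image_add)

lemma bi_edge_minus_star_in_bh_image:
  "x \<in> A \<Longrightarrow> frag_of x + frag_of (bar G x) - star (tgt x) \<in> bh_image"
  unfolding id_minus_bh_frag_of[symmetric] by auto

text \<open>The relations of \<open>x\<close> and \<open>bar G x\<close> contain the same two arcs
  but the stars at opposite ends, so subtracting them identifies these stars; connectedness does the
  rest.\<close>

lemma star_diff_in_bh_image:
  assumes "mconnected (underlying G)" "u \<in> V" "v \<in> V"
  shows "star u - star v \<in> bh_image"
  using assms
proof (induction v rule: connected_induct)
  case base
  show ?case by (simp add: bh_image_zero)
next
  case (step x)
  have "frag_of (bar G x) + frag_of x - star (src x) \<in> bh_image"
    using bi_edge_minus_star_in_bh_image[of "bar G x"] step(1) by simp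
  from bh_image_diff[OF bi_edge_minus_star_in_bh_image[OF step(1)] this]
  have "star (src x) - star (tgt x) \<in> bh_image"
    by (simp add: algebra_simps)
  from bh_image_add[OF step(2) this] show ?case
    by simp
qed

text \<open>
  In the cokernel all stars are equal to one element, which becomes the basis vector \<open>None\<close>, and
  \<open>bar x\<close> is this element minus \<open>x\<close>. The relation at \<open>v\<close> then serves to eliminate \<open>f v\<close>.
\<close>

lemma K0_group_iso_free:
  assumes conn: "mconnected (underlying G)"
    and f: "\<And>v. v \<in> V \<Longrightarrow> f v \<in> A \<and> src (f v) = v"
    and wf: "wf {(u, tgt (f u)) | u. u \<in> V}"
  defines "X \<equiv> {x \<in> arcs0 G. x \<notin> f ` V \<and> bar G x \<notin> f ` V}"
  shows "K0_group G \<cong> free_Abelian_group (insert None (Some ` X))"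
proof -
  define R where "R = {(u, tgt (f u)) | u. u \<in> V}"
  define F where "F = f ` V"
  have wfR: "wf R"
    using wf by (simp add: R_def)
  define S :: "'e option \<Rightarrow>\<^sub>0 int" where "S = frag_of None"
  \<comment> \<open>The map \<open>t\<close> is to become the quotient map, with \<open>S\<close> as
    the common value of the stars. On bi-edges that \<open>f\<close> does not use it is
    \<open>t0\<close>, and the member in \<open>arcs0 G\<close> goes to a basis vector.\<close>
  define t0 where "t0 x = (if x \<in> arcs0 G then frag_of (Some x) else S - frag_of (Some (bar G x)))" for x
  \<comment> \<open>The condition that the star at \<open>v\<close> has value \<open>S\<close>,
    solved for \<open>f v\<close>. If \<open>bar G x \<in> F\<close>, then
    \<open>bar G x = f (tgt x)\<close>, so the value already found at \<open>tgt x\<close>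
    enters.\<close>
  define step where "step h v = S - (\<Sum>x\<in>out_arcs (dgraph G) v - {f v}.
      if bar G x \<in> F then S - h (tgt x) else t0 x)" for h :: "'v \<Rightarrow> 'e option \<Rightarrow>\<^sub>0 int" and v
  define h where "h = wfrec R step"
  define t where "t x = (if x \<in> F then h (src x) else if bar G x \<in> F then S - h (tgt x) else t0 x)" for x
  define Y where "Y = insert None (Some ` X)"
  have F_A: "x \<in> A" if "x \<in> F" for x
    using that f by (auto simp: F_def)
  have f_src: "f (src x) = x" if "x \<in> F" for x
    using that f by (auto simp: F_def)
  \<comment> \<open>Otherwise \<open>R\<close> would relate the two ends of \<open>x\<close> in both
    directions. Hence no bi-edge is eliminated in both of its directions.\<close>
  have F_bar: "bar G x \<notin> F" if "x \<in> F" for x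
  proof
    assume "bar G x \<in> F"
    then have "f (tgt x) = bar G x" "f (src x) = x"
      using that f_src[of "bar G x"] F_A[of x] by (auto simp: f_src)
    then have "(tgt x, src x) \<in> R" "(src x, tgt x) \<in> R"
      unfolding R_def using that F_A[of x] by (auto intro: exI[of _ "src x"] exI[of _ "tgt x"])
    then show False
      using wf_not_sym[OF wfR] by blast
  qed
  \<comment> \<open>The recursive calls of \<open>step\<close> go to predecessors under
    \<open>R\<close>, because \<open>f (tgt x) = bar G x\<close> ends at \<open>v\<close>.\<close>
  have pred: "(tgt x, v) \<in> R" if "x \<in> out_arcs (dgraph G) v" "bar G x \<in> F" for x v
    using that f_src[of "bar G x"] unfolding R_def by (auto intro!: exI[of _ "tgt x"])
  have h: "h v = step h v" for v
  proof -
    have "h v = step (cut h R v) v"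
      unfolding h_def by (rule wfrec[OF wfR])
    also have "\<dots> = step h v"
      unfolding step_def using pred by (intro arg_cong2[where f = minus] sum.cong) (auto simp: cut_apply)
    finally show ?thesis .
  qed
  have t_bar: "t x + t (bar G x) = S" if "x \<in> A" for x
    using that F_bar[of x] bar_in_arcs0_iff[OF that] by (auto simp: t_def t0_def)
  have h_eq: "h v = S - (\<Sum>x\<in>out_arcs (dgraph G) v - {f v}. t x)" for v
  proof -
    have "x \<notin> F" if "x \<in> out_arcs (dgraph G) v - {f v}" for x
      using that f_src[of x] by auto
    then show ?thesis
      unfolding h[of v] step_def t_def
      by (intro arg_cong2[where f = minus] sum.cong) auto
  qed
  have t_f: "t (f v) = h v" if "v \<in> V" for v
    using that f by (simp add: t_def F_def)
  have t_star: "frag_extend t (star v) = S" if "v \<in> V" for v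
  proof -
    have "frag_extend t (star v) = (\<Sum>x\<in>out_arcs (dgraph G) v. t x)"
      unfolding star_def by (subst frag_extend_sum) (auto simp: that finite_out_arcs)
    also have "\<dots> = t (f v) + (\<Sum>x\<in>out_arcs (dgraph G) v - {f v}. t x)"
      using that f by (intro sum.remove) (auto simp: finite_out_arcs)
    finally show ?thesis
      using that by (simp add: t_f h_eq)
  qed
  have keys_S: "Poly_Mapping.keys S \<subseteq> Y"
    by (simp add: S_def Y_def)
  have keys_t0: "Poly_Mapping.keys (t0 x) \<subseteq> Y" if "x \<in> A" "x \<notin> F" "bar G x \<notin> F" for x
  proof (cases "x \<in> arcs0 G")
    case True
    then show ?thesis
      using that by (simp add: t0_def X_def F_def Y_def)
  next
    case False
    then have "bar G x \<in> X"
      using that bar_in_arcs0_iff[of x] by (simp add: X_def F_def)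
    then show ?thesis
      using False keys_diff_subset[OF keys_S, of "frag_of (Some (bar G x))"] by (simp add: t0_def Y_def)
  qed
  have keys_h: "Poly_Mapping.keys (h v) \<subseteq> Y" for v
    using wfR
  proof (induction v rule: wf_induct_rule)
    case (less v)
    have "x \<notin> F" if "x \<in> out_arcs (dgraph G) v - {f v}" for x
      using that f_src[of x] by auto
    then show ?case
      unfolding h[of v] step_def
      by (intro keys_diff_subset[OF keys_S] keys_sum_subset)
        (auto simp: keys_t0 intro!: keys_diff_subset[OF keys_S] less pred)
  qed
  have keys_t: "Poly_Mapping.keys (t x) \<subseteq> Y" if "x \<in> A" for x
    using that keys_h keys_t0[of x] keys_diff_subset[OF keys_S keys_h] unfolding t_def by presburger
  have hom: "frag_extend t \<in> hom (arc_group G) (free_Abelian_group Y)"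
    by (rule frag_extend_hom) (rule keys_t)
  interpret t: group_hom "arc_group G" "free_Abelian_group Y" "frag_extend t"
    using hom by (simp add: group_hom_def group_hom_axioms_def)
  obtain v0 where v0: "v0 \<in> V"
    using conn by (auto simp: mconnected_def underlying_def)
  \<comment> \<open>A right inverse of \<open>t\<close>. Since all stars have value
    \<open>S\<close>, the star at any one vertex \<open>v0\<close> can represent
    \<open>None\<close>.\<close>
  define s where "s = case_option (star v0) (frag_of :: 'e \<Rightarrow> _)"
  have keys_s_basis: "Poly_Mapping.keys (s y) \<subseteq> A" if "y \<in> Y" for y
    using that keys_star arcs0_in_A unfolding Y_def by (elim insertE imageE) (simp_all add: s_def X_def)
  have keys_s: "Poly_Mapping.keys (frag_extend s c) \<subseteq> A" if "Poly_Mapping.keys c \<subseteq> Y" for c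
    by (intro order_trans[OF keys_frag_extend] UN_least keys_s_basis subsetD[OF that])
  have ts: "frag_extend t (frag_extend s c) = c" if "Poly_Mapping.keys c \<subseteq> Y" for c
    using that
  proof (induction c rule: frag_induction)
    case (one y)
    show ?case
    proof (cases y)
      case None
      then show ?thesis
        using t_star[OF v0] by (simp add: s_def S_def)
    next
      case (Some x)
      then show ?thesis
        using one by (auto simp: s_def X_def Y_def t_def t0_def F_def)
    qed
  qed (simp_all add: frag_extend_diff)
  have "frag_extend t ` carrier (arc_group G) = carrier (free_Abelian_group Y)"
  proof (intro equalityI subsetI)
    fix c
    assume "c \<in> carrier (free_Abelian_group Y)"
    then show "c \<in> frag_extend t ` carrier (arc_group G)"
      using ts[of c] keys_s[of c] by (intro image_eqI[of _ _ "frag_extend s c"]) simp_all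
  qed (use hom_carrier[OF hom] in blast)
  moreover have "kernel (arc_group G) (free_Abelian_group Y) (frag_extend t) = bh_image"
  proof (intro equalityI subsetI)
    fix c
    assume "c \<in> bh_image"
    then obtain b where b: "Poly_Mapping.keys b \<subseteq> A" and c: "c = id_minus_bh G b"
      by auto
    have "frag_extend t (id_minus_bh G b) = 0"
      using b
    proof (induction b rule: frag_induction)
      case (one x)
      then show ?case
        using t_bar[of x] t_star[of "tgt x"]
        by (simp add: id_minus_bh_frag_of frag_extend_diff frag_extend_add)
    qed (simp_all add: frag_extend_diff id_minus_bh_diff)
    moreover have "c \<in> carrier (arc_group G)"
      using b c hom_in_carrier[OF id_minus_bh_hom[OF bigraph], of b] by simp
    ultimately show "c \<in> kernel (arc_group G) (free_Abelian_group Y) (frag_extend t)"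
      by (simp add: kernel_def c)
  next
    fix c
    assume "c \<in> kernel (arc_group G) (free_Abelian_group Y) (frag_extend t)"
    then have c: "Poly_Mapping.keys c \<subseteq> A" "frag_extend t c = 0"
      by (auto simp: kernel_def)
    \<comment> \<open>The failure of \<open>s\<close> to be a left inverse of \<open>t\<close>. It
      is zero on the retained arcs of \<open>arcs0 G\<close>, \<open>q_bar\<close> carries
      membership in the image across a bi-edge, and on \<open>F\<close> induction along
      \<open>R\<close> applies.\<close>
    define q where "q x = frag_extend s (t x) - frag_of x" for x
    have sS: "frag_extend s S = star v0"
      by (simp add: s_def S_def)
    have q_bar: "q x \<in> bh_image" if "x \<in> A" "q (bar G x) \<in> bh_image" for x
    proof -
      have "t x = S - t (bar G x)"
        using t_bar[OF that(1)] by (simp add: algebra_simps)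
      then have "q x = (star v0 - star (tgt x)) - q (bar G x)
          - (frag_of x + frag_of (bar G x) - star (tgt x))"
        by (simp add: q_def frag_extend_diff sS)
      also have "\<dots> \<in> bh_image"
        by (intro bh_image_diff star_diff_in_bh_image[OF conn v0] bi_edge_minus_star_in_bh_image
            that tgt_in_V)
      finally show ?thesis .
    qed
    have q0: "q x \<in> bh_image" if "x \<in> A" "x \<notin> F" "bar G x \<notin> F" for x
    proof -
      have *: "q y \<in> bh_image" if "y \<in> arcs0 G" "y \<notin> F" "bar G y \<notin> F" for y
        using that bh_image_zero by (simp add: q_def t_def t0_def s_def)
      show ?thesis
        using *[of x] *[of "bar G x"] that bar_in_arcs0_iff[of x] q_bar[of x] by auto
    qed
    have qf: "q (f v) \<in> bh_image" if "v \<in> V" for v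
      using wfR that
    proof (induction v rule: wf_induct_rule)
      case (less v)
      have "q x \<in> bh_image" if x: "x \<in> out_arcs (dgraph G) v - {f v}" for x
      proof (cases "bar G x \<in> F")
        case True
        then have "q (bar G x) \<in> bh_image"
          using less(1)[of "tgt x"] pred[of x v] x f_src[of "bar G x"] by auto
        then show ?thesis
          using q_bar[of x] x by auto
      next
        case False
        then show ?thesis
          using q0[of x] x f_src[of x] by (cases "x \<in> F") auto
      qed
      then have sum: "(\<Sum>x\<in>out_arcs (dgraph G) v - {f v}. q x) \<in> bh_image"
        by (rule bh_image_sum)
      have "star v = frag_of (f v) + (\<Sum>x\<in>out_arcs (dgraph G) v - {f v}. frag_of x)"
        unfolding star_def using less(2) f by (intro sum.remove) (auto simp: finite_out_arcs)
      then have "q (f v) = (star v0 - star v) - (\<Sum>x\<in>out_arcs (dgraph G) v - {f v}. q x)"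
        using less(2) finite_out_arcs[of v]
        by (simp add: q_def t_f h_eq frag_extend_diff sS frag_extend_sum sum_subtractf)
      also have "\<dots> \<in> bh_image"
        by (intro bh_image_diff star_diff_in_bh_image[OF conn v0] less(2) sum)
      finally show ?case .
    qed
    have qF: "q x \<in> bh_image" if "x \<in> F" for x
      using that qf unfolding F_def by fast
    have q: "q x \<in> bh_image" if "x \<in> A" for x
      using that q0[of x] qF[of x] qF[of "bar G x"] q_bar[of x] by blast
    have "frag_extend s (frag_extend t c) - c \<in> bh_image"
      using c(1)
    proof (induction c rule: frag_induction)
      case (one x)
      then show ?case
        using q[of x] by (simp add: q_def)
    next
      case (diff a b)
      then have "(frag_extend s (frag_extend t a) - a) - (frag_extend s (frag_extend t b) - b) \<in> bh_image"
        by (rule bh_image_diff)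
      then show ?case
        by (simp add: frag_extend_diff algebra_simps)
    qed (simp add: bh_image_zero)
    \<comment> \<open>As \<open>t\<close> annihilates \<open>c\<close>, the fact just proved says
      that \<open>- c\<close> lies in the image.\<close>
    then show "c \<in> bh_image"
      using bh_image_diff[OF bh_image_zero, of "- c"] c(2) by simp
  qed
  ultimately show ?thesis
    using t.FactGroup_iso unfolding K0_group_def Y_def by simp
qed

section \<open>The kernel\<close>

lemma lookup_star:
  assumes "v \<in> V" "y \<in> A"
  shows "Poly_Mapping.lookup (star v) y = (if src y = v then 1 else 0)"
  using assms finite_out_arcs[of v] by (simp add: star_def lookup_sum)

text \<open>The star subtracted for \<open>x\<close> contains \<open>y\<close> exactly when
  \<open>x\<close> ends where \<open>y\<close> starts, hence the sum over the arcs into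
  \<open>src y\<close>.\<close>

lemma lookup_id_minus_bh:
  assumes "Poly_Mapping.keys c \<subseteq> A" "y \<in> A"
  shows "Poly_Mapping.lookup (id_minus_bh G c) y =
    Poly_Mapping.lookup c y + Poly_Mapping.lookup c (bar G y)
      - (\<Sum>x\<in>in_arcs (dgraph G) (src y). Poly_Mapping.lookup c x)"
  using assms(1)
proof (induction c rule: frag_induction)
  case (one x)
  have "bar G x = y \<longleftrightarrow> bar G y = x"
    using one assms(2) by auto
  then show ?case
    using one assms(2) finite_in_arcs[of "src y"]
    by (auto simp: id_minus_bh_frag_of lookup_add lookup_minus lookup_star)
qed (simp_all add: id_minus_bh_diff lookup_minus sum_subtractf)

text \<open>The coefficient formula equates a quantity symmetric in \<open>y\<close> and
  \<open>bar G y\<close> with the inflow at \<open>src y\<close>, so the inflow is the same at all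
  vertices. It is zero at a vertex that the finite support does not reach, which exists since
  \<open>V\<close> is infinite.\<close>

lemma kernel_antisymmetric_flow:
  assumes conn: "mconnected (underlying G)" and inf: "infinite V"
    and c: "Poly_Mapping.keys c \<subseteq> A" "id_minus_bh G c = 0"
  shows "v \<in> V \<Longrightarrow> (\<Sum>x\<in>in_arcs (dgraph G) v. Poly_Mapping.lookup c x) = 0"
    and "y \<in> A \<Longrightarrow> Poly_Mapping.lookup c (bar G y) = - Poly_Mapping.lookup c y"
proof -
  let ?I = "\<lambda>v. \<Sum>x\<in>in_arcs (dgraph G) v. Poly_Mapping.lookup c x"
  have eq: "Poly_Mapping.lookup c y + Poly_Mapping.lookup c (bar G y) = ?I (src y)" if "y \<in> A" for y
    using lookup_id_minus_bh[OF c(1) that] c(2) by simp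
  obtain u where u: "u \<in> V" "u \<notin> tgt ` Poly_Mapping.keys c"
    using inf finite_subset[of V "tgt ` Poly_Mapping.keys c"] by auto
  then have "?I u = 0"
    by (intro sum.neutral) (auto simp: in_keys_iff)
  have flow: "?I v = 0" if "v \<in> V" for v
    using conn u(1) that
  proof (induction v rule: connected_induct)
    case base
    show ?case by fact
  next
    case (step x)
    then show ?case
      using eq[of x] eq[of "bar G x"] by simp
  qed
  then show "v \<in> V \<Longrightarrow> ?I v = 0" .
  show "Poly_Mapping.lookup c (bar G y) = - Poly_Mapping.lookup c y" if "y \<in> A"
    using eq[OF that] flow[of "src y"] that by simp
qed

end

section \<open>Spanning trees\<close>

text \<open>
  The arcs \<open>g v\<close> from the vertices \<open>v \<noteq> r\<close> to their parents make up a spanning tree; \<open>d\<close> is only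
  required to decrease towards the root.
\<close>

locale rooted_bi_graph = bi_graph G for G :: "('v, 'e) bigraph" +
  fixes r :: 'v and d :: "'v \<Rightarrow> nat" and g :: "'v \<Rightarrow> 'e"
  assumes root: "r \<in> V"
    and parent: "v \<in> V \<Longrightarrow> v \<noteq> r \<Longrightarrow> g v \<in> A \<and> src (g v) = v \<and> d (tgt (g v)) < d v"
begin

definition tree_arcs :: "'e set" where
  "tree_arcs = g ` (V - {r}) \<union> (\<lambda>v. bar G (g v)) ` (V - {r})"

lemma parent_arc [simp]: "v \<in> V \<Longrightarrow> v \<noteq> r \<Longrightarrow> g v \<in> A"
  and src_parent_arc [simp]: "v \<in> V \<Longrightarrow> v \<noteq> r \<Longrightarrow> src (g v) = v"
  using parent by auto

lemma tree_arcs_subset: "tree_arcs \<subseteq> A"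
  by (simp add: tree_arcs_def image_subset_iff)

lemma tree_arcs_cases:
  assumes "x \<in> tree_arcs"
  obtains v where "v \<in> V" "v \<noteq> r" "x = g v" | v where "v \<in> V" "v \<noteq> r" "x = bar G (g v)"
  using assms by (auto simp: tree_arcs_def)

lemma bar_in_tree_arcs_iff:
  assumes "x \<in> A"
  shows "bar G x \<in> tree_arcs \<longleftrightarrow> x \<in> tree_arcs"
proof -
  have *: "bar G y \<in> tree_arcs" if "y \<in> tree_arcs" for y
    using that by (cases rule: tree_arcs_cases) (auto simp: tree_arcs_def)
  show ?thesis
    using *[of x] *[of "bar G x"] assms by auto
qed

lemma g_in_tree_arcs: "v \<in> V \<Longrightarrow> v \<noteq> r \<Longrightarrow> g v \<in> tree_arcs"
  by (auto simp: tree_arcs_def)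

lemma parent_induct [consumes 1, case_names root parent]:
  assumes "v \<in> V"
    and "P r"
    and "\<And>v. v \<in> V \<Longrightarrow> v \<noteq> r \<Longrightarrow> P (tgt (g v)) \<Longrightarrow> P v"
  shows "P v"
  using assms(1)
proof (induction "d v" arbitrary: v rule: less_induct)
  case less
  then show ?case
    using assms(2,3) parent[of v] by (cases "v = r") auto
qed

lemma mconnected: "mconnected (underlying G)"
proof -
  let ?R = "{(u, v). \<exists>x\<in>A. src x = u \<and> tgt x = v}"
  have "(v, r) \<in> ?R\<^sup>* \<and> (r, v) \<in> ?R\<^sup>*" if "v \<in> V" for v
    using that
  proof (induction v rule: parent_induct)
    case (parent v)
    have "(v, tgt (g v)) \<in> ?R" "(tgt (g v), v) \<in> ?R"
      using parent(1,2) rooted_bi_graph.parent[OF rooted_bi_graph_axioms, of v]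
      by (auto intro: bexI[of _ "g v"] bexI[of _ "bar G (g v)"])
    then show ?case
      using parent(3) by (meson converse_rtrancl_into_rtrancl rtrancl.rtrancl_into_rtrancl)
  qed simp
  then show ?thesis
    unfolding mconnected_iff using root by (blast intro: rtrancl_trans)
qed

text \<open>The chain is the tree path with each arc minus its reversal. Such a difference maps to
  the star at its source minus the star at its range, so the sum telescopes.\<close>

lemma tree_path_to_root:
  assumes "v \<in> V"
  shows "\<exists>c. Poly_Mapping.keys c \<subseteq> tree_arcs \<and> id_minus_bh G c = star v - star r"
  using assms
proof (induction v rule: parent_induct)
  case root
  show ?case by (rule exI[of _ 0]) simp
next
  case (parent v)
  then obtain c where c: "Poly_Mapping.keys c \<subseteq> tree_arcs" "id_minus_bh G c = star (tgt (g v)) - star r"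
    by blast
  have g: "g v \<in> A" "src (g v) = v" "g v \<in> tree_arcs"
    using parent(1,2) rooted_bi_graph.parent[OF rooted_bi_graph_axioms, of v] g_in_tree_arcs by auto
  show ?case
  proof (intro exI[of _ "frag_of (g v) - frag_of (bar G (g v)) + c"] conjI)
    show "Poly_Mapping.keys (frag_of (g v) - frag_of (bar G (g v)) + c) \<subseteq> tree_arcs"
      using g c(1) by (intro keys_add_subset keys_diff_subset) (auto simp: bar_in_tree_arcs_iff)
    show "id_minus_bh G (frag_of (g v) - frag_of (bar G (g v)) + c) = star v - star r"
      using g c(2) by (simp add: id_minus_bh_add id_minus_bh_diff id_minus_bh_frag_of)
  qed
qed

text \<open>
  Flow conservation at a vertex of maximal depth among those whose parent arc carries flow is
  violated.
\<close>

lemma kernel_eq_zero: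
  assumes inf: "infinite V"
    and c: "Poly_Mapping.keys c \<subseteq> A" "id_minus_bh G c = 0"
    and off: "\<And>x. x \<in> arcs0 G - tree_arcs \<Longrightarrow> Poly_Mapping.lookup c x = 0"
  shows "c = 0"
proof -
  note flow = kernel_antisymmetric_flow[OF mconnected inf c]
  \<comment> \<open>The hypothesis covers only \<open>arcs0 G\<close>; antisymmetry extends it to
    the reversed arcs.\<close>
  have off_tree: "Poly_Mapping.lookup c x = 0" if "x \<notin> tree_arcs" for x
  proof (cases "x \<in> A")
    case True
    then show ?thesis
      using that off[of x] off[of "bar G x"] flow(2)[of x]
      by (auto simp: bar_in_tree_arcs_iff bar_in_arcs0_iff)
  next
    case False
    then show ?thesis
      using c(1) by (auto simp: in_keys_iff subset_iff)
  qed
  define D where "D = {v \<in> V - {r}. Poly_Mapping.lookup c (g v) \<noteq> 0}"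
  have "D = {}"
  proof (rule ccontr)
    assume "D \<noteq> {}"
    moreover have "finite D"
    proof (rule finite_subset)
      show "D \<subseteq> src ` Poly_Mapping.keys c"
      proof
        fix v assume "v \<in> D"
        then show "v \<in> src ` Poly_Mapping.keys c"
          using parent[of v] by (intro image_eqI[of v _ "g v"]) (auto simp: D_def in_keys_iff)
      qed
    qed simp
    ultimately have "Max (d ` D) \<in> d ` D" and max: "\<And>u. u \<in> D \<Longrightarrow> d u \<le> Max (d ` D)"
      by auto
    then obtain v where v: "v \<in> D" "\<And>u. u \<in> D \<Longrightarrow> d u \<le> d v"
      by (metis imageE)
    have vV: "v \<in> V" "v \<noteq> r"
      using v(1) by (auto simp: D_def)
    note gv = parent[OF vV]
    \<comment> \<open>A tree arc into \<open>v\<close> other than the reversed parent arc is the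
      parent arc of a child of \<open>v\<close>, which is deeper and hence outside
      \<open>D\<close>.\<close>
    have "Poly_Mapping.lookup c x = 0" if x: "x \<in> in_arcs (dgraph G) v - {bar G (g v)}" for x
    proof (cases "x \<in> tree_arcs")
      case True
      then show ?thesis
      proof (cases rule: tree_arcs_cases)
        case (1 u)
        then have "u \<notin> D"
          using x v(2)[of u] parent[of u] by auto
        then show ?thesis
          using 1 by (simp add: D_def)
      next
        case (2 u)
        then show ?thesis
          using x parent[of u] by auto
      qed
    qed (rule off_tree)
    then have "(\<Sum>x\<in>in_arcs (dgraph G) v. Poly_Mapping.lookup c x) = Poly_Mapping.lookup c (bar G (g v))"
      using gv vV by (subst sum.remove[of _ "bar G (g v)"]) (auto simp: finite_in_arcs)
    then show False
      using flow(1)[OF vV(1)] flow(2)[of "g v"] gv v(1) by (simp add: D_def)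
  qed
  then have "Poly_Mapping.lookup c x = 0" if "x \<in> tree_arcs" for x
    using that flow(2) by (auto simp: D_def elim!: tree_arcs_cases)
  then show ?thesis
    using off_tree by (intro poly_mapping_eqI) auto
qed

text \<open>The chain \<open>cyc x\<close> is the fundamental cycle of \<open>x\<close>: the arc
  minus its reversal, closed up through the root by tree paths.\<close>

lemma K1_group_iso_free:
  assumes inf: "infinite V"
  shows "free_Abelian_group (arcs0 G - tree_arcs) \<cong> K1_group G"
proof -
  let ?N = "arcs0 G - tree_arcs"
  obtain p where p: "\<And>v. v \<in> V \<Longrightarrow> Poly_Mapping.keys (p v) \<subseteq> tree_arcs"
      "\<And>v. v \<in> V \<Longrightarrow> id_minus_bh G (p v) = star v - star r"
    using tree_path_to_root by metis
  define cyc where "cyc x = frag_of x - frag_of (bar G x) + (p (tgt x) - p (src x))" for x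
  let ?h = "frag_extend cyc"
  have keys_cyc: "Poly_Mapping.keys (cyc x) \<subseteq> A" if "x \<in> A" for x
    unfolding cyc_def using that p(1) tree_arcs_subset
    by (intro keys_add_subset keys_diff_subset) (auto dest: src_in_V tgt_in_V)
  have hom: "?h \<in> hom (free_Abelian_group ?N) (arc_group G)"
    using keys_cyc arcs0_in_A by (intro frag_extend_hom) auto
  have keys_h: "Poly_Mapping.keys (?h c) \<subseteq> A" if "Poly_Mapping.keys c \<subseteq> ?N" for c
    using hom_in_carrier[OF hom, of c] that by simp
  have ker: "id_minus_bh G (?h c) = 0" if "Poly_Mapping.keys c \<subseteq> ?N" for c
    using that
  proof (induction c rule: frag_induction)
    case (one x)
    then have "x \<in> A"
      using arcs0_in_A by auto
    then show ?case
      using p(2) by (simp add: cyc_def id_minus_bh_add id_minus_bh_diff id_minus_bh_frag_of)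
  qed (simp_all add: frag_extend_diff id_minus_bh_diff)
  \<comment> \<open>Among the arcs of the index set, \<open>cyc x\<close> meets only
    \<open>x\<close>: the paths stay in the tree, and \<open>bar G x\<close> lies outside
    \<open>arcs0 G\<close>. Coefficients can therefore be read off, which gives injectivity.\<close>
  have lookup: "Poly_Mapping.lookup (?h c) y = Poly_Mapping.lookup c y"
    if "Poly_Mapping.keys c \<subseteq> ?N" "y \<in> ?N" for c y
    using that(1)
  proof (induction c rule: frag_induction)
    case (one x)
    then have "x \<in> A"
      using arcs0_in_A by auto
    then have "Poly_Mapping.lookup (p (tgt x)) y = 0" "Poly_Mapping.lookup (p (src x)) y = 0"
      using p(1)[of "tgt x"] p(1)[of "src x"] that(2) by (auto simp: in_keys_iff subset_iff)
    moreover have "bar G x \<noteq> y"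
      using one that(2) \<open>x \<in> A\<close> bar_in_arcs0_iff[of x] by auto
    ultimately show ?case
      by (auto simp: cyc_def lookup_add lookup_minus)
  qed (simp_all add: frag_extend_diff lookup_minus)
  have "inj_on ?h (carrier (free_Abelian_group ?N))"
  proof (rule inj_onI)
    fix a b
    assume a: "a \<in> carrier (free_Abelian_group ?N)" and b: "b \<in> carrier (free_Abelian_group ?N)"
      and eq: "?h a = ?h b"
    show "a = b"
    proof (rule poly_mapping_eqI)
      fix y
      show "Poly_Mapping.lookup a y = Poly_Mapping.lookup b y"
      proof (cases "y \<in> ?N")
        case True
        then show ?thesis
          using lookup[of a y] lookup[of b y] a b eq by simp
      next
        case False
        then show ?thesis
          using a b by (metis carrier_free_Abelian_group_iff in_keys_iff subsetD)
      qed
    qed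
  qed
  moreover have "?h ` carrier (free_Abelian_group ?N) = carrier (K1_group G)"
  proof (intro equalityI subsetI)
    fix c
    assume "c \<in> ?h ` carrier (free_Abelian_group ?N)"
    then obtain b where b: "c = ?h b" "Poly_Mapping.keys b \<subseteq> ?N"
      by (elim imageE) simp
    show "c \<in> carrier (K1_group G)"
      unfolding b(1) using keys_h[OF b(2)] ker[OF b(2)] by (simp add: K1_group_def kernel_def)
  next
    fix c
    assume "c \<in> carrier (K1_group G)"
    then have c: "Poly_Mapping.keys c \<subseteq> A" "id_minus_bh G c = 0"
      by (auto simp: K1_group_def kernel_def)
    define c' where "c' = frag_extend (\<lambda>x. if x \<in> ?N then frag_of x else 0) c"
    have keys: "Poly_Mapping.keys c' \<subseteq> ?N"
      unfolding c'_def by (rule order_trans[OF keys_frag_extend]) (auto split: if_splits)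
    have c'_lookup: "Poly_Mapping.lookup c' y = Poly_Mapping.lookup c y" if "y \<in> ?N" for y
      using subset_refl[of "Poly_Mapping.keys c"] unfolding c'_def
    proof (induction c rule: frag_induction)
      case (one x)
      then show ?case using that by auto
    qed (simp_all add: frag_extend_diff lookup_minus)
    \<comment> \<open>Subtracting the fundamental cycles with the coefficients of \<open>c\<close>
      leaves a kernel element that vanishes on the index set.\<close>
    have "c - ?h c' = 0"
    proof (rule kernel_eq_zero[OF inf])
      show "Poly_Mapping.keys (c - ?h c') \<subseteq> A"
        by (intro keys_diff_subset c(1) keys_h keys)
      show "id_minus_bh G (c - ?h c') = 0"
        using c(2) ker[OF keys] by (simp add: id_minus_bh_diff)
    qed (use lookup[OF keys] c'_lookup in \<open>simp add: lookup_minus\<close>)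
    then show "c \<in> ?h ` carrier (free_Abelian_group ?N)"
      using keys by (intro image_eqI[of _ _ c']) auto
  qed
  moreover have "?h \<in> hom (free_Abelian_group ?N) (K1_group G)"
    using keys_h ker by (simp add: hom_def Pi_iff K1_group_def kernel_def frag_extend_add)
  ultimately show ?thesis
    unfolding is_iso_def iso_def bij_betw_def by blast
qed

text \<open>At a vertex of maximal \<open>d\<close> on a cycle, both the incoming and the outgoing
  edge would be the parent edge. Distinctness of the edges leaves only a loop, and the ends of a
  parent edge differ in \<open>d\<close>.\<close>

lemma mtree_if_arcs_subset_tree_arcs:
  assumes "A \<subseteq> tree_arcs"
  shows "mtree (underlying G)"
proof -
  have False if cycle: "mcycle (underlying G) vs bs" for vs bs
  proof -
    let ?L = "length bs"
    have L: "0 < ?L" "length vs = ?L" "distinct bs" "set bs \<subseteq> medges (underlying G)"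
        "\<And>i. i < ?L \<Longrightarrow> src ` (bs ! i) = {vs ! i, vs ! (Suc i mod ?L)}"
      using cycle by (auto simp: mcycle_def underlying_def)
    have edge: "\<exists>u\<in>V - {r}. bs ! i = {g u, bar G (g u)}" if i: "i < ?L" for i
    proof -
      obtain x where x: "x \<in> tree_arcs" "bs ! i = {x, bar G x}"
        using subsetD[OF L(4) nth_mem[OF i]] assms by (auto simp: underlying_def)
      from x(1) show ?thesis
      proof (cases rule: tree_arcs_cases)
        case (2 u)
        then show ?thesis
          using x(2) parent[of u] by auto
      qed (use x(2) in auto)
    qed
    have "Max (d ` set vs) \<in> d ` set vs"
      using L(1,2) by (intro Max_in) auto
    then obtain j where "j < ?L" "d (vs ! j) = Max (d ` set vs)"
      using L(2) by (auto simp: in_set_conv_nth)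
    then have j: "j < ?L" "\<And>k. k < ?L \<Longrightarrow> d (vs ! k) \<le> d (vs ! j)"
      using L(2) by auto
    \<comment> \<open>The edge joins some \<open>u\<close> to its parent, which has smaller
      \<open>d\<close>; maximality at \<open>vs ! j\<close> forces
      \<open>vs ! j = u\<close>.\<close>
    have parent_edge: "bs ! i = {g (vs ! j), bar G (g (vs ! j))} \<and> d (vs ! i) \<noteq> d (vs ! (Suc i mod ?L))"
      if i: "i < ?L" and "vs ! j \<in> {vs ! i, vs ! (Suc i mod ?L)}" for i
    proof -
      obtain u where u: "u \<in> V" "u \<noteq> r" "bs ! i = {g u, bar G (g u)}"
        using edge[OF i] by auto
      then have ends: "{u, tgt (g u)} = {vs ! i, vs ! (Suc i mod ?L)}"
        using L(5)[OF i] parent[of u] by simp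
      have "Suc i mod ?L < ?L"
        using L(1) by simp
      then have "d u \<le> d (vs ! j)"
        using ends j(2) i by (metis insert_iff singletonD)
      then have "vs ! j = u"
        using that(2) ends parent[OF u(1,2)] by auto
      then show ?thesis
        using u ends parent[OF u(1,2)] by (auto simp: doubleton_eq_iff)
    qed
    \<comment> \<open>The cyclic predecessor of \<open>j\<close>; adding \<open>?L\<close> first
      keeps the subtraction valid for \<open>j = 0\<close>.\<close>
    define i where "i = (j + ?L - 1) mod ?L"
    have i: "i < ?L" "Suc i mod ?L = j"
      using L(1) j(1) by (auto simp: i_def mod_Suc_eq)
    have "bs ! i = bs ! j"
      using parent_edge[of i] parent_edge[of j] i j(1) by auto
    then have "i = j"
      using L(3) i(1) j(1) by (simp add: nth_eq_iff_index_eq)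
    then show False
      using parent_edge[of j] i j(1) by auto
  qed
  then show ?thesis
    using mconnected by (auto simp: mtree_def)
qed

text \<open>The tree arcs are closed under \<open>bar\<close> and contain all parent arcs, so the
  same rooting data serve the tree alone, to which the acyclicity result then applies.\<close>

lemma rooted_bi_graph_restrict_tree_arcs:
  "rooted_bi_graph (restrict_arcs G tree_arcs) r d g"
proof -
  note tree = tree_arcs_subset[THEN subsetD] bar_in_tree_arcs_iff
  have bij: "bij_betw (bar G) (S \<inter> tree_arcs) (S' \<inter> tree_arcs)"
    if "bij_betw (bar G) S S'" "S \<subseteq> A" for S S'
  proof -
    have "bar G ` (S \<inter> tree_arcs) = S' \<inter> tree_arcs"
      using that bar_in_tree_arcs_iff unfolding bij_betw_def by blast
    then show ?thesis
      using that(1) unfolding bij_betw_def by (auto intro: inj_on_subset)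
  qed
  have "wf_digraph (dgraph (restrict_arcs G tree_arcs))"
    using tree(1) by (auto simp: wf_digraph_def restrict_arcs_def)
  moreover have "locally_finite (dgraph (restrict_arcs G tree_arcs))"
    unfolding locally_finite_def
  proof
    fix v
    assume "v \<in> verts (dgraph (restrict_arcs G tree_arcs))"
    then have "finite (out_arcs (dgraph G) v \<union> in_arcs (dgraph G) v)"
      by (simp add: restrict_arcs_def finite_out_arcs finite_in_arcs)
    then show "finite (out_arcs (dgraph (restrict_arcs G tree_arcs)) v
        \<union> in_arcs (dgraph (restrict_arcs G tree_arcs)) v)"
      by (rule rev_finite_subset) (auto simp: restrict_arcs_def tree(1))
  qed
  ultimately have "is_bigraph (restrict_arcs G tree_arcs)"
    using bigraph tree bij[of "arcs0 G" "arcs1 G"] bij[of "arcs1 G" "arcs0 G"]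
    unfolding is_bigraph_def by (auto simp: restrict_arcs_def)
  then show ?thesis
    using root parent by unfold_locales (auto simp: restrict_arcs_def g_in_tree_arcs)
qed

lemma mtree_restrict_tree_arcs: "mtree (underlying (restrict_arcs G tree_arcs))"
proof -
  interpret R: rooted_bi_graph "restrict_arcs G tree_arcs" r d g
    by (rule rooted_bi_graph_restrict_tree_arcs)
  show ?thesis
    using R.mtree_if_arcs_subset_tree_arcs unfolding R.tree_arcs_def
    by (simp add: restrict_arcs_def tree_arcs_def[symmetric])
qed

section \<open>Routes to infinity\<close>

definition descendants :: "'v \<Rightarrow> 'v set" where
  "descendants v = {u \<in> V. (u, v) \<in> {(u, tgt (g u)) | u. u \<in> V - {r}}\<^sup>*}"

lemma descendants_root: "descendants r = V"
proof -
  have "(v, r) \<in> {(u, tgt (g u)) | u. u \<in> V - {r}}\<^sup>*" if "v \<in> V" for v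
    using that
  proof (induction v rule: parent_induct)
    case (parent v)
    then have "(v, tgt (g v)) \<in> {(u, tgt (g u)) | u. u \<in> V - {r}}"
      by blast
    then show ?case
      using parent(3) by (rule converse_rtrancl_into_rtrancl)
  qed simp
  then show ?thesis
    by (auto simp: descendants_def)
qed

lemma depth_descendants:
  assumes "u \<in> descendants v"
  shows "d v \<le> d u"
proof -
  have "(u, v) \<in> {(u, tgt (g u)) | u. u \<in> V - {r}}\<^sup>*"
    using assms by (simp add: descendants_def)
  then show ?thesis
  proof induction
    case (step y z)
    then show ?case
      using parent[of y] by auto
  qed simp
qed

text \<open>Strictness makes the number of descendants grow when a route climbs to a parent.\<close>

lemma descendants_psubset_parent:
  assumes "v \<in> V" "v \<noteq> r"
  shows "descendants v \<subset> descendants (tgt (g v))"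
proof -
  have "(v, tgt (g v)) \<in> {(u, tgt (g u)) | u. u \<in> V - {r}}"
    using assms by blast
  then have "descendants v \<subseteq> descendants (tgt (g v))"
    unfolding descendants_def by (auto intro: rtrancl_into_rtrancl)
  moreover have "tgt (g v) \<in> descendants (tgt (g v))" "tgt (g v) \<notin> descendants v"
    using parent[OF assms] depth_descendants[of "tgt (g v)" v] by (auto simp: descendants_def)
  ultimately show ?thesis
    by blast
qed

text \<open>The step of Koenig's lemma: by local finiteness there are finitely many children, and
  every descendant other than \<open>v\<close> descends from one of them.\<close>

lemma infinite_descendants_child:
  assumes "v \<in> V" "infinite (descendants v)"
  shows "\<exists>u\<in>V - {r}. tgt (g u) = v \<and> infinite (descendants u)"
proof (rule ccontr)
  assume *: "\<not> ?thesis"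
  define C where "C = {u \<in> V - {r}. tgt (g u) = v}"
  have "C \<subseteq> src ` in_arcs (dgraph G) v"
  proof
    fix u assume "u \<in> C"
    then show "u \<in> src ` in_arcs (dgraph G) v"
      using parent[of u] by (intro image_eqI[of u _ "g u"]) (auto simp: C_def)
  qed
  then have "finite C"
    using finite_in_arcs[OF assms(1)] by (meson finite_imageI finite_subset)
  then have "finite (insert v (\<Union>u\<in>C. descendants u))"
    using * by (auto simp: C_def)
  moreover have "descendants v \<subseteq> insert v (\<Union>u\<in>C. descendants u)"
  proof
    fix w
    assume "w \<in> descendants v"
    then have w: "w \<in> V" "(w, v) \<in> {(u, tgt (g u)) | u. u \<in> V - {r}}\<^sup>*"
      by (simp_all add: descendants_def)
    from w(2) show "w \<in> insert v (\<Union>u\<in>C. descendants u)"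
    proof (cases rule: rtranclE)
      case (step u)
      then show ?thesis
        using w(1) by (auto simp: descendants_def C_def)
    qed simp
  qed
  ultimately show False
    using assms(2) finite_subset by blast
qed

text \<open>
  Leave every vertex towards infinity: to a child with infinitely many descendants if there is
  one, and to the parent otherwise. The vertices whose route passes through a given vertex then form
  a finite set, so that the routes are well-founded backwards.
\<close>

lemma routes_to_infinity:
  assumes "infinite V"
  obtains f where "\<And>v. v \<in> V \<Longrightarrow> f v \<in> tree_arcs \<and> src (f v) = v"
    and "wf {(u, tgt (f u)) | u. u \<in> V}"
proof -
  obtain c where c: "\<And>v. v \<in> V \<Longrightarrow> infinite (descendants v) \<Longrightarrow>
      c v \<in> V - {r} \<and> tgt (g (c v)) = v \<and> infinite (descendants (c v))"
    using infinite_descendants_child by metis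
  define f where "f v = (if infinite (descendants v) then bar G (g (c v)) else g v)" for v
  \<comment> \<open>This rank increases lexicographically along a route: while the descendants are
    finite in number the route climbs and their number grows; afterwards it descends forever and
    \<open>d\<close> grows.\<close>
  define m where "m v = (if infinite (descendants v) then (1::nat, d v) else (0, card (descendants v)))" for v
  have ne: "v \<noteq> r" if "finite (descendants v)" for v
    using that assms descendants_root by auto
  have f: "f v \<in> tree_arcs \<and> src (f v) = v" if "v \<in> V" for v
  proof (cases "infinite (descendants v)")
    case True
    then show ?thesis
      using c[OF that] parent[of "c v"] by (auto simp: f_def tree_arcs_def)
  next
    case False
    then show ?thesis
      using ne parent[of v] that by (auto simp: f_def g_in_tree_arcs)
  qed
  have "(m u, m (tgt (f u))) \<in> less_than <*lex*> less_than" if "u \<in> V" for u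
  proof (cases "infinite (descendants u)")
    case True
    then show ?thesis
      using c[OF that] parent[of "c u"] by (auto simp: f_def m_def)
  next
    case False
    then show ?thesis
      using ne[of u] descendants_psubset_parent[OF that]
      by (auto simp: f_def m_def psubset_card_mono)
  qed
  then have "{(u, tgt (f u)) | u. u \<in> V} \<subseteq> inv_image (less_than <*lex*> less_than) m"
    by (auto simp: inv_image_def)
  then have "wf {(u, tgt (f u)) | u. u \<in> V}"
    by (rule wf_subset[rotated]) auto
  with f show ?thesis
    by (rule that)
qed

section \<open>Turning the bi-edges outside a tree into loops\<close>

text \<open>Both members of a bi-edge outside the tree become loops at the source of its
  \<open>arcs0\<close> member. Arcs, \<open>bar\<close> and \<open>arcs0\<close> are kept, so the
  index sets of the bases can be compared literally.\<close>

definition rose_tree :: "('v, 'e) bigraph" where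
  "rose_tree = G\<lparr>dgraph := (dgraph G)
     \<lparr>tail := \<lambda>x. if x \<in> tree_arcs \<or> x \<in> arcs0 G then src x else tgt x,
      head := \<lambda>x. if x \<notin> tree_arcs \<and> x \<in> arcs0 G then src x else tgt x\<rparr>\<rparr>"

text \<open>Local finiteness survives because every loop is placed at an end that its arc already
  had.\<close>

lemma is_bigraph_rose_tree: "is_bigraph rose_tree"
proof -
  have "locally_finite (dgraph rose_tree)"
    unfolding locally_finite_def
  proof
    fix v
    assume "v \<in> verts (dgraph rose_tree)"
    then have "finite (out_arcs (dgraph G) v \<union> in_arcs (dgraph G) v)"
      by (simp add: rose_tree_def finite_out_arcs finite_in_arcs)
    then show "finite (out_arcs (dgraph rose_tree) v \<union> in_arcs (dgraph rose_tree) v)"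
      by (rule rev_finite_subset) (auto simp: rose_tree_def split: if_splits)
  qed
  moreover have "wf_digraph (dgraph rose_tree)"
    by (auto simp: wf_digraph_def rose_tree_def)
  ultimately show ?thesis
    using bigraph bar_in_arcs0_iff bar_in_tree_arcs_iff
    unfolding is_bigraph_def by (auto simp: rose_tree_def)
qed

lemma rooted_bi_graph_rose_tree: "rooted_bi_graph rose_tree r d g"
  using root parent is_bigraph_rose_tree g_in_tree_arcs
  by unfold_locales (auto simp: rose_tree_def)

lemma tree_arcs_rose_tree: "rooted_bi_graph.tree_arcs rose_tree r g = tree_arcs"
  unfolding rooted_bi_graph.tree_arcs_def[OF rooted_bi_graph_rose_tree] tree_arcs_def
  by (simp add: rose_tree_def)

lemma rose_tree_bigraph_rose_tree: "rose_tree_bigraph rose_tree"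
proof -
  interpret T: rooted_bi_graph rose_tree r d g
    by (rule rooted_bi_graph_rose_tree)
  interpret R: rooted_bi_graph "restrict_arcs rose_tree tree_arcs" r d g
    using T.rooted_bi_graph_restrict_tree_arcs by (simp add: tree_arcs_rose_tree)
  show ?thesis
    unfolding rose_tree_bigraph_def
  proof (intro conjI exI)
    show "arcs (dgraph rose_tree) = tree_arcs \<union> (A - tree_arcs)"
      using tree_arcs_subset by (auto simp: rose_tree_def)
    show "mtree (underlying (restrict_arcs rose_tree tree_arcs))"
      using T.mtree_restrict_tree_arcs by (simp add: tree_arcs_rose_tree)
    show "\<forall>x\<in>A - tree_arcs. tail (dgraph rose_tree) x = head (dgraph rose_tree) x"
      by (simp add: rose_tree_def)
  qed (use T.bigraph R.bigraph in auto)
qed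

text \<open>Both kernels are indexed by \<open>arcs0 G - tree_arcs\<close>, which the construction
  leaves unchanged.\<close>

lemma K1_group_rose_tree_iso:
  assumes "infinite V"
  shows "K1_group G \<cong> K1_group rose_tree"
proof -
  interpret T: rooted_bi_graph rose_tree r d g
    by (rule rooted_bi_graph_rose_tree)
  have "free_Abelian_group (arcs0 G - tree_arcs) \<cong> K1_group rose_tree"
    using T.K1_group_iso_free assms by (simp add: tree_arcs_rose_tree) (simp add: rose_tree_def)
  moreover have "K1_group G \<cong> free_Abelian_group (arcs0 G - tree_arcs)"
    using K1_group_iso_free[OF assms] by (rule group.iso_sym[OF group_free_Abelian_group])
  ultimately show ?thesis
    by (rule iso_trans[rotated])
qed

text \<open>The routes \<open>f\<close> use only tree arcs, whose ends do not move, so the same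
  \<open>f\<close> is admissible for both graphs and yields the same basis.\<close>

lemma K0_group_rose_tree_iso:
  assumes "infinite V"
  shows "K0_group G \<cong> K0_group rose_tree"
proof -
  interpret T: rooted_bi_graph rose_tree r d g
    by (rule rooted_bi_graph_rose_tree)
  obtain f where f: "\<And>v. v \<in> V \<Longrightarrow> f v \<in> tree_arcs \<and> src (f v) = v"
      and wf: "wf {(u, tgt (f u)) | u. u \<in> V}"
    using routes_to_infinity[OF assms] by blast
  let ?F = "free_Abelian_group (insert None (Some ` {x \<in> arcs0 G. x \<notin> f ` V \<and> bar G x \<notin> f ` V}))"
  have "K0_group G \<cong> ?F"
    using f tree_arcs_subset by (intro K0_group_iso_free mconnected wf) auto
  moreover have "K0_group rose_tree \<cong> ?F"
  proof -
    have "{(u, tgt (f u)) | u. u \<in> V} = {(u, T.tgt (f u)) | u. u \<in> T.V}"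
      using f by (auto simp: rose_tree_def)
    then have "wf {(u, T.tgt (f u)) | u. u \<in> T.V}"
      using wf by simp
    moreover have "f v \<in> T.A \<and> T.src (f v) = v" if "v \<in> T.V" for v
      using f[of v] that tree_arcs_subset by (auto simp: rose_tree_def)
    ultimately have "K0_group rose_tree \<cong> free_Abelian_group (insert None
        (Some ` {x \<in> arcs0 rose_tree. x \<notin> f ` T.V \<and> bar rose_tree x \<notin> f ` T.V}))"
      by (intro T.K0_group_iso_free T.mconnected) auto
    then show ?thesis
      by (simp add: rose_tree_def)
  qed
  \<comment> \<open>Required for inverting the second isomorphism.\<close>
  moreover have "group (K0_group rose_tree)"
  proof -
    interpret h: group_hom "arc_group rose_tree" "arc_group rose_tree" "id_minus_bh rose_tree"
      using id_minus_bh_hom[OF T.bigraph] by (simp add: group_hom_def group_hom_axioms_def)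
    show ?thesis
      unfolding K0_group_def
      by (intro normal.factorgroup_is_group comm_group.subgroup_imp_normal
          abelian_free_Abelian_group h.img_is_subgroup)
  qed
  ultimately show ?thesis
    using group.iso_sym iso_trans by blast
qed

end

section \<open>Existence of a spanning tree, and the conclusion\<close>

lemma (in bi_graph) obtain_rooted_bi_graph:
  assumes "mconnected (underlying G)"
  obtains r d g where "rooted_bi_graph G r d g"
proof -
  let ?R = "{(u, v). \<exists>x\<in>A. src x = u \<and> tgt x = v}"
  obtain r where r: "r \<in> V" "\<And>v. v \<in> V \<Longrightarrow> (r, v) \<in> ?R\<^sup>*"
    using assms unfolding mconnected_iff by auto
  \<comment> \<open>The distance from \<open>r\<close>, so that the resulting tree is a
    breadth-first tree.\<close>
  define d where "d v = (LEAST n. (r, v) \<in> ?R ^^ n)" for v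
  have "\<exists>x. x \<in> A \<and> src x = v \<and> d (tgt x) < d v" if v: "v \<in> V" "v \<noteq> r" for v
  proof -
    have d: "(r, v) \<in> ?R ^^ d v"
      unfolding d_def using rtrancl_imp_relpow[OF r(2)[OF v(1)]] by (auto intro: LeastI)
    obtain n where n: "d v = Suc n"
      using d v(2) by (cases "d v") auto
    then obtain u where u: "(r, u) \<in> ?R ^^ n" "(u, v) \<in> ?R"
      using d by auto
    then obtain x where x: "x \<in> A" "src x = u" "tgt x = v"
      by auto
    have "d u \<le> n"
      unfolding d_def using u(1) by (rule Least_le)
    \<comment> \<open>The last arc \<open>x\<close> of a shortest walk from \<open>r\<close> to
      \<open>v\<close> is reversed to point to the parent.\<close>
    then show ?thesis
      using x n by (intro exI[of _ "bar G x"]) auto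
  qed
  then obtain g where "\<And>v. v \<in> V \<Longrightarrow> v \<noteq> r \<Longrightarrow> g v \<in> A \<and> src (g v) = v \<and> d (tgt (g v)) < d v"
    by metis
  then have "rooted_bi_graph G r d g"
    using r(1) by unfold_locales auto
  then show ?thesis
    by (rule that)
qed

theorem theorem5p1:
  fixes E :: "('v, 'e) bigraph"
  assumes "is_bigraph E"
    and "mconnected (underlying E)"
    and "minfinite (underlying E)"
  shows "\<exists>T :: ('v, 'e) bigraph. rose_tree_bigraph T \<and>
           K0_group E \<cong> K0_group T \<and> K1_group E \<cong> K1_group T"
proof -
  interpret bi_graph E
    using assms(1) by (rule bi_graph.intro)
  obtain r d g where "rooted_bi_graph E r d g"
    using obtain_rooted_bi_graph[OF assms(2)] by blast
  then interpret rooted_bi_graph E r d g .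
  have "infinite V"
    using assms(3) by (simp add: minfinite_def underlying_def)
  then show ?thesis
    using rose_tree_bigraph_rose_tree K0_group_rose_tree_iso K1_group_rose_tree_iso by blast
qed

end
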